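(* Let $G$ be a finite group, $H\le G$ a subgroup, $N\triangleleft G$ a normal subgroup, and $k,\ell\in\mathbb N$. 1. $\mathsf d_k(N)+\mathsf d_\ell(G/N)\le\mathsf d_{k+\ell-1}(G)$. 2. $\mathsf d_k(G)\le\mathsf d_{\mathsf d_k(N)+1}(G/N)$. 3. $\mathsf d_k(G)+1\le[G:H](\mathsf d_k(H)+1)$. 4. $\mathsf d_k(G)+1\le k(\mathsf d(G)+1)$. 5. $\mathsf D_k(G)\le[G:H]\,\mathsf D_k(H)$.
   Context: For a finite group $G$ (written multiplicatively), a sequence over $G$ is an element of the free abelian monoid $\mathcal F(G)$ with basis $G$; its length $|S|$ is the number of terms counted with multiplicity. A sequence is a product-one sequence if its terms can be ordered so that their product is $1_G$; $\mathcal B(G)\subset\mathcal F(G)$ is the submonoid of product-one sequences. The set $\mathsf L(A)$ of lengths of $A\in\mathcal B(G)$ is the set of all $l$ such that $A$ is a product of $l$ atoms (irreducible elements) of $\mathcal B(G)$, with $\mathsf L(1)=\{0\}$. The large $k$th Davenport constant is $\mathsf D_k(G)=\sup\{|A|\colon A\in\mathcal B(G),\ \max\mathsf L(A)\le k\}$. The small $k$th Davenport constant $\mathsf d_k(G)$ is the supremum of $|S|$ over all $S\in\mathcal F(G)$ that are not divisible in $\mathcal F(G)$ by a product of $k$ nontrivial product-one sequences; $\mathsf d(G)=\mathsf d_1(G)$. *)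

theory Defs
  imports "HOL-Algebra.Coset" "HOL-Algebra.Divisibility"
    "HOL-Library.Multiset" "HOL-Library.Extended_Nat"
begin

definition sequences_over :: "('a, 'b) monoid_scheme \<Rightarrow> 'a multiset set" where
  "sequences_over G = {S. set_mset S \<subseteq> carrier G}"

definition product_one :: "('a, 'b) monoid_scheme \<Rightarrow> 'a multiset \<Rightarrow> bool" where
  "product_one G S \<longleftrightarrow>
     S \<in> sequences_over G \<and> (\<exists>xs. mset xs = S \<and> foldr (\<otimes>\<^bsub>G\<^esub>) xs \<one>\<^bsub>G\<^esub> = \<one>\<^bsub>G\<^esub>)"

text \<open>The monoid \<open>\<B>(G)\<close>, as a structure in its own right: irreducibility in \<open>\<B>(G)\<close>
  refers to factorisations whose factors are themselves product-one sequences.\<close>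

definition product_one_monoid :: "('a, 'b) monoid_scheme \<Rightarrow> 'a multiset monoid" where
  "product_one_monoid G = \<lparr>carrier = {S. product_one G S}, mult = (+), one = {#}\<rparr>"

text \<open>\<^const>\<open>factors\<close> demands that the entries of the list be irreducible, but not that they lie in
  the carrier. For the empty sequence only the empty list qualifies, which is the
  convention \<open>\<L>(1) = {0}\<close>.\<close>

definition length_set :: "('a, 'b) monoid_scheme \<Rightarrow> 'a multiset \<Rightarrow> nat set" where
  "length_set G A = {length fs | fs.
     set fs \<subseteq> carrier (product_one_monoid G) \<and> factors (product_one_monoid G) fs A}"

lemma length_set_empty: "length_set G {#} = {0}"
proof -
  have unit: "{#} \<in> Units (product_one_monoid G)"
    by (auto simp: Units_def product_one_monoid_def product_one_def sequences_over_def)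
  have "fs = []" if "factors (product_one_monoid G) fs {#}" for fs
    using that unit
    by (cases fs) (auto simp: factors_def irreducible_def product_one_monoid_def)
  moreover have "factors (product_one_monoid G) [] {#}"
    by (simp add: factors_def product_one_monoid_def)
  ultimately show ?thesis
    unfolding length_set_def by force
qed

text \<open>Suprema are taken in \<^typ>\<open>enat\<close>, so that no finiteness is built into the definitions.\<close>

definition large_davenport :: "nat \<Rightarrow> ('a, 'b) monoid_scheme \<Rightarrow> enat" where
  "large_davenport k G =
     (SUP A \<in> {A. product_one G A \<and> Max (length_set G A) \<le> k}. enat (size A))"

text \<open>Divisibility in the free abelian monoid over \<^term>\<open>carrier G\<close> is the
  sub-multiset relation.\<close>

definition divisible_by_product_ones :: "nat \<Rightarrow> ('a, 'b) monoid_scheme \<Rightarrow> 'a multiset \<Rightarrow> bool" where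
  "divisible_by_product_ones k G S \<longleftrightarrow>
     (\<exists>Ts. length Ts = k \<and> (\<forall>T\<in>set Ts. product_one G T \<and> T \<noteq> {#}) \<and> sum_list Ts \<subseteq># S)"

definition small_davenport :: "nat \<Rightarrow> ('a, 'b) monoid_scheme \<Rightarrow> enat" where
  "small_davenport k G =
     (SUP S \<in> {S \<in> sequences_over G. \<not> divisible_by_product_ones k G S}. enat (size S))"

end

theory Submission imports Defs begin

text \<open>Most of the five inequalities rest on one mechanism. Suppose disjoint subsequences of a sequence over
  \<open>G\<close>, each with a chosen ordering (called blocks here), have products lying in a subgroup \<open>H\<close>. The
  products form a sequence over \<open>H\<close>, and every product-one subsequence of it expands, by concatenating
  the blocks behind its terms, to a product-one subsequence of the original one
  (\<open>substitute_blocks\<close>). So a sequence over \<open>G\<close> that contains more than \<open>d\<^sub>k(H)\<close> disjoint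
  blocks is divisible by \<open>k\<close> nontrivial product-one sequences (\<open>divisible_of_many_blocks\<close>), and it
  remains to find many blocks.

  For a subgroup \<open>H\<close> of index \<open>c\<close>, blocks come from the pigeonhole principle: among the \<open>c t + 1\<close>
  suffix products of a word of length \<open>c t\<close> some \<open>t + 1\<close> lie in the same right coset of \<open>H\<close>, and
  cutting the word at these places gives \<open>t\<close> consecutive blocks (\<open>long_word_blocks\<close>). This gives
  \<open>d\<^sub>k(G) + 1 \<le> c (d\<^sub>k(H) + 1)\<close>; the trivial subgroup shows that all small Davenport constants
  are finite. For the large constant the blocks have to use up the whole sequence. If its product is
  one, the letters before the first cut can be joined cyclically to those after the last cut and form
  one further block (\<open>product_one_word_cyclic_blocks\<close>). As \<open>max L(A) \<le> k\<close> says exactly that \<open>A\<close>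
  is not a product of more than \<open>k\<close> nontrivial product-one sequences, which need not be atoms
  (\<open>Max_length_set_le_iff\<close>), substitution of blocks gives the bound.

  For a normal subgroup \<open>N\<close>, a product-one sequence over \<open>G/N\<close> lifts to a block with product in \<open>N\<close>,
  whence \<open>d\<^sub>k(G) \<le> d\<^bsub>m+1\<^esub>(G/N)\<close> for \<open>m = d\<^sub>k(N)\<close>. For the lower bound on
  \<open>d\<^bsub>k+l-1\<^esub>(G)\<close>, take an extremal sequence over \<open>N\<close> together with a lift of an extremal
  sequence over \<open>G/N\<close>: a product-one subsequence either lies in the first part or maps, after removal
  of identity elements, to a nontrivial product-one subsequence of the second, so that at most
  \<open>(k - 1) + (l - 1)\<close> of them can be disjoint. The bound \<open>d\<^sub>k(G) + 1 \<le> k (d(G) + 1)\<close> follows by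
  splitting off one product-one sequence from each of \<open>k\<close> pieces of length \<open>d(G) + 1\<close>.\<close>

section \<open>Words and families of disjoint subsequences\<close>

text \<open>For \<open>H = {1}\<close> these are the orderings that witness nontrivial product-one sequences. A list of
  such words stands for a family of disjoint subsequences of \<open>S\<close> when the multiset of all its letters
  is contained in \<open>S\<close>.\<close>

definition block_words :: "('a, 'b) monoid_scheme \<Rightarrow> 'a set \<Rightarrow> 'a list set" where
  "block_words G H =
     {w. w \<noteq> [] \<and> set w \<subseteq> carrier G \<and> foldr (\<otimes>\<^bsub>G\<^esub>) w \<one>\<^bsub>G\<^esub> \<in> H}"

lemma mset_eq_image_mset_lift:
  assumes "mset xs = image_mset f W"
  obtains ys where "map f ys = xs" and "mset ys = W"
  using assms
proof (induction xs arbitrary: W thesis)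
  case (Cons x xs)
  have "x \<in># image_mset f W"
    using Cons.prems(2) by (metis list.set_intros(1) set_mset_mset)
  then obtain y W' where y: "W = add_mset y W'" "x = f y"
    by (auto dest: multi_member_split)
  then have "mset xs = image_mset f W'" using Cons.prems(2) by simp
  then obtain ys where "map f ys = xs" "mset ys = W'"
    using Cons.IH by blast
  then show ?case using Cons.prems(1)[of "y # ys"] y by simp
qed simp

lemma map_eq_concat_lift:
  assumes "map f ys = concat xss"
  obtains yss where "map (map f) yss = xss" and "concat yss = ys"
  using assms
proof (induction xss arbitrary: ys thesis)
  case (Cons xs xss)
  then obtain ys1 ys2 where "ys = ys1 @ ys2" "map f ys1 = xs" "map f ys2 = concat xss"
    by (auto simp: map_eq_append_conv)
  moreover then obtain yss where "map (map f) yss = xss" "concat yss = ys2"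
    using Cons.IH by blast
  ultimately show ?case using Cons.prems(1)[of "ys1 # yss"] by simp
qed simp

text \<open>A family of disjoint subsequences of an image multiset can be pulled back because the
  concatenated words lift letter by letter and the lift is then cut at the same places. The last
  clause covers families that exhaust the multiset, as needed for factorisations rather than
  divisibility.\<close>

lemma words_lift:
  assumes "mset (concat xss) \<subseteq># image_mset f W"
  obtains yss where "map (map f) yss = xss" and "mset (concat yss) \<subseteq># W"
    and "mset (concat xss) = image_mset f W \<Longrightarrow> mset (concat yss) = W"
proof -
  obtain V where V: "V \<subseteq># W" "image_mset f V = mset (concat xss)"
  proof -
    obtain C where "image_mset f W = mset (concat xss) + C"
      using assms by (metis subset_mset.add_diff_inverse)
    then obtain B' C' where "W = B' + C'" "mset (concat xss) = image_mset f B'"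
      using image_mset_eq_plusD by blast
    then show thesis using that[of B'] by simp
  qed
  obtain ys where ys: "map f ys = concat xss" "mset ys = V"
    using mset_eq_image_mset_lift V(2) by metis
  obtain yss where yss: "map (map f) yss = xss" "concat yss = ys"
    using map_eq_concat_lift[OF ys(1)] by blast
  show thesis
  proof (rule that[OF yss(1)])
    show "mset (concat yss) \<subseteq># W" using V ys yss by simp
    assume "mset (concat xss) = image_mset f W"
    then have "size V = size W" using V by (metis size_image_mset)
    then show "mset (concat yss) = W" using V ys yss
      by (metis subset_mset.le_imp_less_or_eq mset_subset_size nat_neq_iff)
  qed
qed

lemma nontrivial_product_ones_iff_words:
  "(\<forall>T\<in>set Ts. product_one G T \<and> T \<noteq> {#}) \<longleftrightarrow>
   (\<exists>ws. map mset ws = Ts \<and> ws \<in> lists (block_words G {\<one>\<^bsub>G\<^esub>}))"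
proof (induction Ts)
  case (Cons T Ts)
  have "(product_one G T \<and> T \<noteq> {#}) \<longleftrightarrow> (\<exists>w \<in> block_words G {\<one>\<^bsub>G\<^esub>}. mset w = T)"
    by (auto simp: product_one_def block_words_def sequences_over_def)
  moreover have "(\<exists>ws. map mset ws = T # Ts \<and> ws \<in> lists (block_words G {\<one>\<^bsub>G\<^esub>})) \<longleftrightarrow>
      (\<exists>w \<in> block_words G {\<one>\<^bsub>G\<^esub>}. mset w = T) \<and>
      (\<exists>ws. map mset ws = Ts \<and> ws \<in> lists (block_words G {\<one>\<^bsub>G\<^esub>}))"
    (is "?l \<longleftrightarrow> ?r")
  proof
    assume ?l
    then obtain ws where "map mset ws = T # Ts" "ws \<in> lists (block_words G {\<one>\<^bsub>G\<^esub>})"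
      by (elim exE conjE)
    then show ?r by (cases ws) auto
  next
    assume ?r
    then obtain w ws where "w \<in> block_words G {\<one>\<^bsub>G\<^esub>}" "mset w = T"
      "map mset ws = Ts" "ws \<in> lists (block_words G {\<one>\<^bsub>G\<^esub>})"
      by (elim exE conjE bexE)
    then show ?l by (intro exI[of _ "w # ws"]) simp
  qed
  ultimately show ?case using Cons.IH by simp
qed simp

lemma divisible_by_product_ones_iff_words:
  "divisible_by_product_ones k G S \<longleftrightarrow>
   (\<exists>ws \<in> lists (block_words G {\<one>\<^bsub>G\<^esub>}). length ws = k \<and> mset (concat ws) \<subseteq># S)"
proof -
  have "divisible_by_product_ones k G S \<longleftrightarrow>
      (\<exists>ws \<in> lists (block_words G {\<one>\<^bsub>G\<^esub>}). length (map mset ws) = k \<and> sum_list (map mset ws) \<subseteq># S)"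
    unfolding divisible_by_product_ones_def nontrivial_product_ones_iff_words by blast
  then show ?thesis by (simp add: mset_concat)
qed

text \<open>The bound \<open>k \<le> length ws\<close> instead of an equality lets constructions overshoot; surplus words are
  dropped.\<close>

lemma divisible_by_product_onesI:
  assumes "ws \<in> lists (block_words G {\<one>\<^bsub>G\<^esub>})" "mset (concat ws) \<subseteq># S" "k \<le> length ws"
  shows "divisible_by_product_ones k G S"
proof -
  have "mset (concat (take k ws)) \<subseteq># mset (concat ws)"
    by (metis append_take_drop_id concat_append mset_append mset_subset_eq_add_left)
  then show ?thesis
    unfolding divisible_by_product_ones_iff_words
    using assms by (intro bexI[of _ "take k ws"]) (auto dest: in_set_takeD)
qed

lemma mset_filter_concat_subseteq:
  assumes "mset (concat ws) \<subseteq># S"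
  shows "mset (concat (filter P ws)) \<subseteq># S"
proof -
  have "mset (concat (filter P ws)) \<subseteq># mset (concat ws)"
    by (induction ws) (auto intro: subset_mset.order_trans subset_mset.add_left_mono)
  then show ?thesis using assms by (rule subset_mset.order_trans)
qed

section \<open>Blocks with product in a subgroup\<close>

context group
begin

abbreviation word_prod :: "'a list \<Rightarrow> 'a" where
  "word_prod xs \<equiv> foldr (\<otimes>) xs \<one>"

lemma word_prod_closed [simp]: "set xs \<subseteq> carrier G \<Longrightarrow> word_prod xs \<in> carrier G"
  by (induction xs) auto

lemma word_prod_append:
  "set xs \<subseteq> carrier G \<Longrightarrow> set ys \<subseteq> carrier G \<Longrightarrow>
   word_prod (xs @ ys) = word_prod xs \<otimes> word_prod ys"
  by (induction xs) (auto simp: m_assoc)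

lemma word_prod_concat:
  "\<forall>w\<in>set ws. set w \<subseteq> carrier G \<Longrightarrow> word_prod (concat ws) = word_prod (map word_prod ws)"
proof (induction ws)
  case (Cons w ws)
  then have "set w \<subseteq> carrier G" "set (concat ws) \<subseteq> carrier G" by auto
  then show ?case using Cons by (simp add: word_prod_append del: foldr_append)
qed simp

text \<open>The two products are conjugate in \<open>G\<close>.\<close>

lemma word_prod_rotate:
  assumes "set xs \<subseteq> carrier G" "set ys \<subseteq> carrier G" "word_prod (xs @ ys) = \<one>"
  shows "word_prod (ys @ xs) = \<one>"
  using assms by (simp add: word_prod_append inv_comm del: foldr_append)

lemma word_prod_mem_subgroup:
  assumes "subgroup H G" "set xs \<subseteq> H"
  shows "word_prod xs \<in> H"
  using assms(2) by (induction xs) (auto intro: subgroup.m_closed[OF assms(1)] subgroup.one_closed[OF assms(1)])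

lemma word_prod_concat_blocks:
  assumes "subgroup H G" "ws \<in> lists (block_words G H)"
  shows "word_prod (concat ws) \<in> H"
proof -
  have "word_prod (concat ws) = word_prod (map word_prod ws)"
    using assms(2) by (intro word_prod_concat) (auto simp: block_words_def)
  also have "\<dots> \<in> H"
    using assms by (intro word_prod_mem_subgroup) (auto simp: block_words_def)
  finally show ?thesis .
qed

text \<open>Let \<open>q\<^sub>i\<close> be the product of the letters from position \<open>i\<close> on. If \<open>q\<^sub>i\<close> and \<open>q\<^sub>j\<close> lie in one
  right coset of \<open>H\<close> and \<open>i < j\<close>, then the word between the two positions has product
  \<open>q\<^sub>i q\<^sub>j\<^sup>-\<^sup>1 \<in> H\<close>. Cutting at all positions of a coset \<open>C\<close> therefore yields blocks. The positions
  include the end of the word, where the suffix is empty. The last conclusion, that the suffix from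
  the first cut on has product in \<open>C\<close>, is what the induction needs when a new first cut
  appears.\<close>

lemma cut_at_coset:
  assumes H: "subgroup H G" and C: "C \<in> rcosets H" and "set xs \<subseteq> carrier G"
    and "card {i. i \<le> length xs \<and> word_prod (drop i xs) \<in> C} = Suc t"
  obtains u ws v where "xs = u @ concat ws @ v" "length ws = t" "ws \<in> lists (block_words G H)"
    "word_prod (concat ws @ v) \<in> C"
  using assms(3,4)
proof (induction xs arbitrary: t thesis)
  case Nil
  have "{i. i \<le> length [] \<and> word_prod (drop i []) \<in> C} = (if \<one> \<in> C then {0} else {})" by auto
  then have "\<one> \<in> C \<and> t = 0" using Nil.prems(3) by (auto split: if_splits)
  then show ?case using Nil.prems(1)[of "[]" "[]" "[]"] by simp
next
  case (Cons x xs)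
  let ?I = "{i. i \<le> length xs \<and> word_prod (drop i xs) \<in> C}"
  let ?J = "{i. i \<le> length (x # xs) \<and> word_prod (drop i (x # xs)) \<in> C}"
  have J: "?J = (if word_prod (x # xs) \<in> C then {0} else {}) \<union> Suc ` ?I"
  proof (rule Set.set_eqI)
    fix i show "i \<in> ?J \<longleftrightarrow> i \<in> (if word_prod (x # xs) \<in> C then {0} else {}) \<union> Suc ` ?I"
      by (cases i) auto
  qed
  have fin: "finite ?I" by simp
  have xs: "set xs \<subseteq> carrier G" using Cons.prems(2) by simp
  have cI: "card (Suc ` ?I) = card ?I" by (rule card_image) simp
  show ?case
  proof (cases "word_prod (x # xs) \<in> C")
    case False
    then have "card ?I = Suc t" using Cons.prems(3) J cI by simp
    then obtain u ws v where "xs = u @ concat ws @ v" "length ws = t"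
        "ws \<in> lists (block_words G H)" "word_prod (concat ws @ v) \<in> C"
      using Cons.IH[OF _ xs] by blast
    then show ?thesis using Cons.prems(1)[of "x # u" ws v] by simp
  next
    case True
    have "card ?J = Suc (card ?I)"
      unfolding J using True fin cI by (simp add: card_insert_if image_iff)
    then have cIt: "card ?I = t" using Cons.prems(3) by simp
    \<comment> \<open>A cut at the first letter: the letters up to the next cut become a block, unless this cut is
      the only one.\<close>
    show ?thesis
    proof (cases t)
      case 0
      then show ?thesis using Cons.prems(1)[of "[]" "[]" "x # xs"] True by simp
    next
      case (Suc s)
      then obtain u ws v where *: "xs = u @ concat ws @ v" "length ws = s"
        "ws \<in> lists (block_words G H)" "word_prod (concat ws @ v) \<in> C"
        using Cons.IH[OF _ xs, of s] cIt by blast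
      have carr: "set (x # u) \<subseteq> carrier G" "set (concat ws @ v) \<subseteq> carrier G"
        using Cons.prems(2) *(1) by auto
      have eq: "word_prod (x # xs) = word_prod (x # u) \<otimes> word_prod (concat ws @ v)"
        using word_prod_append[OF carr] *(1) by simp
      have "word_prod (x # u) \<in> H"
      proof -
        have "C = H #> word_prod (concat ws @ v)"
        proof -
          obtain a where a: "a \<in> carrier G" "C = H #> a"
            using C by (auto simp: RCOSETS_def)
          then show ?thesis using repr_independence *(4) H by simp
        qed
        then have "word_prod (x # xs) \<in> H #> word_prod (concat ws @ v)" using True by simp
        then obtain h where h: "h \<in> H" "word_prod (x # u) \<otimes> word_prod (concat ws @ v)
            = h \<otimes> word_prod (concat ws @ v)"
          using eq by (auto simp: r_coset_def)
        have "word_prod (x # u) = h"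
          using h(2) r_cancel[OF _ word_prod_closed[OF carr(1)] subgroup.mem_carrier[OF H h(1)]
              , of "word_prod (concat ws @ v)"] word_prod_closed[OF carr(2)] by blast
        then show ?thesis using h by simp
      qed
      then have "x # u \<in> block_words G H" using carr by (simp add: block_words_def)
      then show ?thesis
        using Cons.prems(1)[of "[]" "(x # u) # ws" v] * True Suc by simp
    qed
  qed
qed


text \<open>A word of length \<open>n\<close> has \<open>n + 1\<close> suffixes, counting the empty one, so \<open>n \<ge> [G:H] t\<close> forces
  more than \<open>t\<close> suffix products into one coset.\<close>

lemma long_word_blocks:
  assumes H: "subgroup H G" and fin: "finite (rcosets H)" and xs: "set xs \<subseteq> carrier G"
    and len: "card (rcosets H) * t \<le> length xs"
  obtains u ws v where "xs = u @ concat ws @ v" "ws \<in> lists (block_words G H)" "t \<le> length ws"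
proof -
  let ?n = "length xs" and ?c = "card (rcosets H)"
  define f where "f i = H #> word_prod (drop i xs)" for i
  have closed: "word_prod (drop i xs) \<in> carrier G" for i
    using xs by (meson set_drop_subset subset_trans word_prod_closed)
  have f: "f \<in> {..?n} \<rightarrow> rcosets H"
    unfolding f_def using rcosetsI[OF subgroup.subset[OF H] closed] by auto
  have ne: "rcosets H \<noteq> {}" using subgroup.subgroup_in_rcosets[OF H is_group] by blast
  obtain C where C: "C \<in> rcosets H" and le: "card {..?n} \<le> card (f -` {C} \<inter> {..?n}) * ?c"
    using pigeonhole_card[OF f _ fin ne] by auto
  let ?I = "{i. i \<le> length xs \<and> word_prod (drop i xs) \<in> C}"
  have "f -` {C} \<inter> {..?n} \<subseteq> ?I"
    unfolding f_def using rcos_self[OF closed H] by auto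
  then have "card (f -` {C} \<inter> {..?n}) \<le> card ?I" by (intro card_mono) auto
  then have "card (f -` {C} \<inter> {..?n}) * ?c \<le> card ?I * ?c" by (rule mult_le_mono1)
  then have "t * ?c < card ?I * ?c" using le len by (simp only: card_atMost mult.commute[of t])
  then have "t < card ?I" by (simp only: mult_less_cancel2)
  then obtain s where s: "card ?I = Suc s" "t \<le> s" by (cases "card ?I") auto
  show thesis
    using cut_at_coset[OF H C xs s(1)] s(2) that by metis
qed

lemma block_words_subgroup:
  assumes "H \<subseteq> carrier G"
  shows "block_words (G\<lparr>carrier := H\<rparr>) K = {w \<in> block_words G K. set w \<subseteq> H}"
  using assms by (auto simp: block_words_def)

text \<open>A product-one word in the products of blocks becomes a product-one word in the letters of the blocks
  once each product is replaced by its block: concatenating blocks multiplies their products in the same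
  order. Blocks are nonempty, so nontriviality is preserved.\<close>

lemma substitute_blocks:
  assumes ws: "ws \<in> lists (block_words G H)" and xss: "xss \<in> lists (block_words G {\<one>})"
    and sub: "mset (concat xss) \<subseteq># mset (map word_prod ws)"
  obtains yss where "yss \<in> lists (block_words G {\<one>})" "length yss = length xss"
    "mset (concat yss) \<subseteq># mset (concat ws)"
    "mset (concat xss) = mset (map word_prod ws) \<Longrightarrow> mset (concat yss) = mset (concat ws)"
proof -
  obtain wss where wss: "map (map word_prod) wss = xss" "mset (concat wss) \<subseteq># mset ws"
    "mset (concat xss) = mset (map word_prod ws) \<Longrightarrow> mset (concat wss) = mset ws"
    using words_lift[of xss word_prod "mset ws"] sub by auto
  have mset_concat_sum_mset: "mset (concat L) = sum_mset (image_mset mset (mset L))" for L :: "'a list list"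
    by (induction L) auto
  have flat: "concat (map concat wss) = concat (concat wss)"
    by (induction wss) auto
  have mem: "w \<in> block_words G H" if "us \<in> set wss" "w \<in> set us" for us w
  proof -
    have "w \<in> set ws" using that set_mset_mono[OF wss(2)] by auto
    then show ?thesis using ws by auto
  qed
  show thesis
  proof (rule that[of "map concat wss"])
    show "map concat wss \<in> lists (block_words G {\<one>})"
    proof -
      have "concat us \<in> block_words G {\<one>}" if us: "us \<in> set wss" for us
      proof -
        have "map word_prod us \<in> set xss" using wss(1) us by auto
        then have *: "us \<noteq> []" "word_prod (map word_prod us) = \<one>"
          using xss by (auto simp: block_words_def)
        have carr: "\<forall>w\<in>set us. set w \<subseteq> carrier G" and ne: "\<forall>w\<in>set us. w \<noteq> []"
          using mem[OF us] by (auto simp: block_words_def)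
        have "concat us \<noteq> []" using *(1) ne by (cases us) auto
        moreover have "set (concat us) \<subseteq> carrier G" using carr by auto
        moreover have "word_prod (concat us) = \<one>" using word_prod_concat[OF carr] * by simp
        ultimately show ?thesis by (simp add: block_words_def)
      qed
      then show ?thesis by auto
    qed
    show "length (map concat wss) = length xss" using wss(1) by auto
    show "mset (concat (map concat wss)) \<subseteq># mset (concat ws)"
      unfolding flat mset_concat_sum_mset using wss(2)
      by (metis image_mset_union mset_subset_eq_add_left subset_mset.add_diff_inverse sum_mset.union)
    show "mset (concat (map concat wss)) = mset (concat ws)"
      if "mset (concat xss) = mset (map word_prod ws)"
      unfolding flat mset_concat_sum_mset wss(3)[OF that] ..
  qed
qed

end

section \<open>Suprema and finiteness\<close>

lemma small_davenport_leI:
  assumes "\<And>S. S \<in> sequences_over G \<Longrightarrow> m < size S \<Longrightarrow> divisible_by_product_ones k G S"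
  shows "small_davenport k G \<le> enat m"
  unfolding small_davenport_def using assms by (intro SUP_least) (auto simp: not_less[symmetric])

lemma small_davenport_leD:
  assumes "small_davenport k G \<le> enat m" "S \<in> sequences_over G" "m < size S"
  shows "divisible_by_product_ones k G S"
proof (rule ccontr)
  assume "\<not> ?thesis"
  then have "enat (size S) \<le> small_davenport k G"
    unfolding small_davenport_def using assms(2) by (intro SUP_upper) auto
  then have "enat (size S) \<le> enat m" using assms(1) by (rule order_trans)
  then show False using assms(3) by simp
qed

lemma small_davenport_geI:
  assumes "S \<in> sequences_over G" "\<not> divisible_by_product_ones k G S"
  shows "enat (size S) \<le> small_davenport k G"
  unfolding small_davenport_def using assms by (intro SUP_upper) auto

text \<open>The supremum must be taken over a nonempty set: for \<open>k \<ge> 1\<close> the empty sequence belongs to it,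
  whereas every sequence is divisible by the empty product when \<open>k = 0\<close>.\<close>

lemma small_davenport_attained:
  assumes "small_davenport k G = enat m" "k \<ge> 1"
  obtains S where "S \<in> sequences_over G" "\<not> divisible_by_product_ones k G S" "size S = m"
proof -
  have "\<exists>S \<in> sequences_over G. \<not> divisible_by_product_ones k G S \<and> m \<le> size S"
  proof (cases m)
    case 0
    have "\<not> divisible_by_product_ones k G {#}"
      using assms(2) by (auto simp: divisible_by_product_ones_iff_words block_words_def
          lists_eq_set length_Suc_conv Suc_le_eq gr0_conv_Suc)
    then show ?thesis using 0 by (intro bexI[of _ "{#}"]) (auto simp: sequences_over_def)
  next
    case (Suc r)
    show ?thesis
    proof (rule ccontr)
      assume "\<not> ?thesis"
      then have "small_davenport k G \<le> enat r"
        using Suc by (intro small_davenport_leI) auto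
      then show False using assms(1) Suc by simp
    qed
  qed
  then obtain S where S: "S \<in> sequences_over G" "\<not> divisible_by_product_ones k G S" "m \<le> size S"
    by blast
  moreover have "size S \<le> m" using small_davenport_geI[OF S(1,2)] assms(1) by simp
  ultimately show thesis using that by simp
qed

context group
begin

lemma finite_rcosets:
  "finite (carrier G) \<Longrightarrow> subgroup H G \<Longrightarrow> finite (rcosets H)"
  by (meson finite_Pow_iff finite_subset rcosets_subset_PowG)

lemma card_rcosets_pos:
  "finite (carrier G) \<Longrightarrow> subgroup H G \<Longrightarrow> 0 < card (rcosets H)"
  using finite_rcosets subgroup.subgroup_in_rcosets[OF _ is_group] by (auto simp: card_gt_0_iff)

lemma long_sequence_blocks:
  assumes "subgroup H G" "finite (carrier G)" "S \<in> sequences_over G"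
    and "card (rcosets H) * t \<le> size S"
  obtains ws where "ws \<in> lists (block_words G H)" "t \<le> length ws" "mset (concat ws) \<subseteq># S"
proof -
  obtain xs where xs: "mset xs = S" using ex_mset by blast
  then have "set xs \<subseteq> carrier G" "card (rcosets H) * t \<le> length xs"
    using assms(3,4) by (auto simp: sequences_over_def)
  then obtain u ws v where *: "xs = u @ concat ws @ v" "ws \<in> lists (block_words G H)" "t \<le> length ws"
    using long_word_blocks[OF assms(1) finite_rcosets[OF assms(2,1)]] by metis
  have "mset (concat ws) \<subseteq># S" using xs *(1) by auto
  then show thesis using that * by blast
qed

text \<open>Blocks for the trivial subgroup are themselves product-one words, so every sequence of length at least
  \<open>k |G|\<close> is divisible by \<open>k\<close> of them.\<close>

lemma small_davenport_finite:
  assumes "finite (carrier G)"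
  obtains m where "small_davenport k G = enat m"
proof -
  have "small_davenport k G \<le> enat (card (rcosets {\<one>}) * k)"
  proof (rule small_davenport_leI)
    fix S assume "S \<in> sequences_over G" "card (rcosets {\<one>}) * k < size S"
    then obtain ws where "ws \<in> lists (block_words G {\<one>})" "k \<le> length ws" "mset (concat ws) \<subseteq># S"
      using long_sequence_blocks[OF triv_subgroup assms] by (metis less_imp_le)
    then show "divisible_by_product_ones k G S" by (blast intro: divisible_by_product_onesI)
  qed
  then show thesis using that by (metis enat_ile)
qed

text \<open>More than \<open>d\<^sub>k(H)\<close> block products form a sequence over \<open>H\<close> that is divisible by \<open>k\<close> nontrivial
  product-one sequences; these expand to product-one sequences over \<open>G\<close>.\<close>

lemma divisible_of_many_blocks:
  assumes H: "subgroup H G" and m: "small_davenport k (G\<lparr>carrier := H\<rparr>) = enat m"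
    and ws: "ws \<in> lists (block_words G H)" "m < length ws" "mset (concat ws) \<subseteq># S"
  shows "divisible_by_product_ones k G S"
proof -
  have "divisible_by_product_ones k (G\<lparr>carrier := H\<rparr>) (mset (map word_prod ws))"
    using ws m by (intro small_davenport_leD[of _ _ m]) (auto simp: sequences_over_def block_words_def)
  then obtain xss where xss: "xss \<in> lists (block_words G {\<one>})" "length xss = k"
      "mset (concat xss) \<subseteq># mset (map word_prod ws)"
    by (auto simp: divisible_by_product_ones_iff_words block_words_subgroup[OF subgroup.subset[OF H]])
  obtain yss where "yss \<in> lists (block_words G {\<one>})" "length yss = k"
      "mset (concat yss) \<subseteq># mset (concat ws)"
    using substitute_blocks[OF ws(1) xss(1,3)] xss(2) by metis
  then show ?thesis using ws(3) divisible_by_product_onesI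
    by (metis order_refl subset_mset.order_trans)
qed


section \<open>Subgroups and multiples for the small constants\<close>

theorem small_davenport_index_bound:
  assumes H: "subgroup H G" and fin: "finite (carrier G)"
  shows "small_davenport k G + 1
    \<le> enat (card (rcosets H)) * (small_davenport k (G\<lparr>carrier := H\<rparr>) + 1)"
proof -
  let ?c = "card (rcosets H)"
  interpret H: group "G\<lparr>carrier := H\<rparr>" using subgroup.subgroup_is_group[OF H is_group] .
  have "finite H" using subgroup.subset[OF H] fin by (rule finite_subset)
  then obtain m where m: "small_davenport k (G\<lparr>carrier := H\<rparr>) = enat m"
    using H.small_davenport_finite[of k] by auto
  have pos: "0 < ?c" using card_rcosets_pos[OF fin H] .
  have "small_davenport k G \<le> enat (?c * (m + 1) - 1)"
  proof (rule small_davenport_leI)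
    fix S assume S: "S \<in> sequences_over G" "?c * (m + 1) - 1 < size S"
    then have "?c * (m + 1) \<le> size S" by simp
    then obtain ws where "ws \<in> lists (block_words G H)" "m + 1 \<le> length ws" "mset (concat ws) \<subseteq># S"
      using long_sequence_blocks[OF H fin S(1)] by blast
    then show "divisible_by_product_ones k G S" using divisible_of_many_blocks[OF H m] by simp
  qed
  then have "small_davenport k G + 1 \<le> enat (?c * (m + 1) - 1) + 1" by (rule add_right_mono)
  also have "\<dots> = enat (?c * (m + 1))" using pos by (simp add: one_enat_def)
  also have "\<dots> = enat ?c * (small_davenport k (G\<lparr>carrier := H\<rparr>) + 1)"
    unfolding m by (simp add: one_enat_def)
  finally show ?thesis .
qed

text \<open>Greedy extraction: every piece of length \<open>d(G) + 1\<close> contains a nontrivial product-one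
  subsequence, so one can be taken from each of \<open>k\<close> disjoint pieces.\<close>

theorem small_davenport_le_mult:
  assumes fin: "finite (carrier G)" and k: "k \<ge> 1"
  shows "small_davenport k G + 1 \<le> enat k * (small_davenport 1 G + 1)"
proof -
  obtain d where d: "small_davenport 1 G = enat d" using small_davenport_finite[OF fin] .
  have greedy: "divisible_by_product_ones k G S"
    if "S \<in> sequences_over G" "k * (d + 1) \<le> size S" for k S
    using that
  proof (induction k arbitrary: S)
    case 0
    then show ?case by (intro divisible_by_product_onesI[of "[]"]) auto
  next
    case (Suc k)
    obtain xs where xs: "mset xs = S" using ex_mset by blast
    let ?S1 = "mset (take (d + 1) xs)" and ?S2 = "mset (drop (d + 1) xs)"
    have S: "S = ?S1 + ?S2" using xs by (metis append_take_drop_id mset_append)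
    have len: "length xs = size S" using xs by auto
    have seq: "?S1 \<in> sequences_over G" "?S2 \<in> sequences_over G"
      using Suc.prems(1) S by (auto simp: sequences_over_def)
    have "divisible_by_product_ones 1 G ?S1"
      using d seq(1) len Suc.prems(2) by (intro small_davenport_leD[of _ _ d]) auto
    then obtain ws1 where ws1: "ws1 \<in> lists (block_words G {\<one>})" "length ws1 = 1"
        "mset (concat ws1) \<subseteq># ?S1"
      by (auto simp: divisible_by_product_ones_iff_words)
    have "divisible_by_product_ones k G ?S2"
      using Suc.prems(2) len by (intro Suc.IH seq(2)) auto
    then obtain ws2 where ws2: "ws2 \<in> lists (block_words G {\<one>})" "length ws2 = k"
        "mset (concat ws2) \<subseteq># ?S2"
      by (auto simp: divisible_by_product_ones_iff_words)
    have "mset (concat (ws1 @ ws2)) \<subseteq># S"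
      using subset_mset.add_mono[OF ws1(3) ws2(3)] S by simp
    then show ?case using ws1 ws2 by (intro divisible_by_product_onesI[of "ws1 @ ws2"]) auto
  qed
  have "small_davenport k G \<le> enat (k * (d + 1) - 1)"
    by (rule small_davenport_leI) (auto intro!: greedy)
  then have "small_davenport k G + 1 \<le> enat (k * (d + 1) - 1) + 1" by (rule add_right_mono)
  also have "\<dots> = enat (k * (d + 1))" using k by (simp add: one_enat_def)
  also have "\<dots> = enat k * (small_davenport 1 G + 1)" unfolding d by (simp add: one_enat_def)
  finally show ?thesis .
qed

end

section \<open>Normal subgroups and quotients\<close>

context normal
begin

lemma word_prod_cosets:
  assumes "set xs \<subseteq> carrier G"
  shows "foldr (\<otimes>\<^bsub>G Mod H\<^esub>) (map ((#>) H) xs) \<one>\<^bsub>G Mod H\<^esub> = H #> word_prod xs"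
  using assms
proof (induction xs)
  case Nil
  then show ?case using coset_mult_one[OF subset] by simp
qed (simp add: rcos_sum)

lemma cosets_trivial_iff: "x \<in> carrier G \<Longrightarrow> H #> x = H \<longleftrightarrow> x \<in> H"
  using coset_join1[OF _ _ is_subgroup] coset_join2[OF _ is_subgroup] by blast

text \<open>A word whose image in \<open>G/H\<close> has product one has its own product in \<open>H\<close>.\<close>

lemma lift_quotient_blocks:
  assumes S: "S \<in> sequences_over G"
    and div: "divisible_by_product_ones t (G Mod H) (image_mset ((#>) H) S)"
  obtains ws where "ws \<in> lists (block_words G H)" "length ws = t" "mset (concat ws) \<subseteq># S"
proof -
  obtain xss where xss: "xss \<in> lists (block_words (G Mod H) {\<one>\<^bsub>G Mod H\<^esub>})" "length xss = t"
      "mset (concat xss) \<subseteq># image_mset ((#>) H) S"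
    using div by (auto simp: divisible_by_product_ones_iff_words)
  obtain ws where ws: "map (map ((#>) H)) ws = xss" "mset (concat ws) \<subseteq># S"
    using words_lift[OF xss(3)] by metis
  have "w \<in> block_words G H" if w: "w \<in> set ws" for w
  proof -
    have "set w \<subseteq> set_mset S" using set_mset_mono[OF ws(2)] w by auto
    then have carr: "set w \<subseteq> carrier G" using S by (auto simp: sequences_over_def)
    have "map ((#>) H) w \<in> set xss" using ws(1) w by auto
    then have "w \<noteq> []" "foldr (\<otimes>\<^bsub>G Mod H\<^esub>) (map ((#>) H) w) \<one>\<^bsub>G Mod H\<^esub> = H"
      using xss(1) by (auto simp: block_words_def)
    then show ?thesis
      using carr word_prod_cosets[OF carr] cosets_trivial_iff[OF word_prod_closed[OF carr]]
      by (auto simp: block_words_def)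
  qed
  then have "ws \<in> lists (block_words G H)" by blast
  moreover have "length ws = t" using ws(1) xss(2) by auto
  ultimately show thesis using that ws(2) by blast
qed

text \<open>A sequence over \<open>G\<close> that is not divisible by \<open>k\<close> nontrivial product-one sequences maps to
  a sequence of the same length over \<open>G/H\<close>. Were the image divisible by \<open>m + 1\<close> nontrivial product-one sequences, they would lift to \<open>m + 1\<close> blocks with products
  in \<open>H\<close>, one more than \<open>d\<^sub>k(H) = m\<close> permits.\<close>

theorem small_davenport_le_quotient:
  assumes m: "small_davenport k (G\<lparr>carrier := H\<rparr>) = enat m"
  shows "small_davenport k G \<le> small_davenport (m + 1) (G Mod H)"
  unfolding small_davenport_def[of k G]
proof (rule SUP_least, clarify)
  fix S assume S: "S \<in> sequences_over G" "\<not> divisible_by_product_ones k G S"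
  let ?T = "image_mset ((#>) H) S"
  have "\<not> divisible_by_product_ones (m + 1) (G Mod H) ?T"
  proof
    assume "divisible_by_product_ones (m + 1) (G Mod H) ?T"
    then obtain ws where "ws \<in> lists (block_words G H)" "length ws = m + 1" "mset (concat ws) \<subseteq># S"
      using lift_quotient_blocks[OF S(1)] by blast
    then show False using S(2) divisible_of_many_blocks[OF is_subgroup m] by simp
  qed
  moreover have "?T \<in> sequences_over (G Mod H)"
    using S(1) by (auto simp: sequences_over_def carrier_FactGroup)
  ultimately show "enat (size S) \<le> small_davenport (m + 1) (G Mod H)"
    using small_davenport_geI by fastforce
qed

text \<open>Letters from \<open>H\<close> are invisible modulo \<open>H\<close>. The letters are given through a map \<open>f\<close> so that the
  filter may depend on more than the group element.\<close>

lemma coset_word_prod_filter: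
  assumes "f ` set v \<subseteq> carrier G" "\<forall>p\<in>set v. \<not> P p \<longrightarrow> f p \<in> H"
  shows "H #> word_prod (map f (filter P v)) = H #> word_prod (map f v)"
  using assms
proof (induction v)
  case (Cons p v)
  then have p: "f p \<in> carrier G" and v: "set (map f v) \<subseteq> carrier G"
    and IH: "H #> word_prod (map f (filter P v)) = H #> word_prod (map f v)" by auto
  have fv: "set (map f (filter P v)) \<subseteq> carrier G" using v by auto
  show ?case
  proof (cases "P p")
    case True
    then show ?thesis
      using rcos_sum[OF p word_prod_closed[OF fv]] rcos_sum[OF p word_prod_closed[OF v]] IH by simp
  next
    case False
    then have "H #> f p = H" using Cons.prems p cosets_trivial_iff by simp
    then have "H #> (f p \<otimes> word_prod (map f v)) = H #> word_prod (map f v)"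
      using coset_mult_assoc[OF subset p word_prod_closed[OF v]] by simp
    then show ?thesis using False IH by simp
  qed
qed simp

text \<open>Let \<open>S\<close> over \<open>H\<close> and \<open>T\<close> over \<open>G/H\<close> be extremal and let \<open>R\<close> lift \<open>T\<close> to \<open>G\<close>. Among disjoint
  product-one words in \<open>S + R\<close>, fewer than \<open>k\<close> use letters of \<open>S\<close> only. Each of the others has a
  nonempty part in \<open>R\<close>, and the image of this part in \<open>G/H\<close> is a product-one word, since the
  letters of \<open>S\<close> map to the identity; so there are fewer than \<open>l\<close> of these. Hence \<open>k + l - 1\<close>
  disjoint product-one words cannot exist.\<close>

theorem small_davenport_extension:
  assumes fin: "finite (carrier G)" and k: "k \<ge> 1" and l: "l \<ge> 1"
  shows "small_davenport k (G\<lparr>carrier := H\<rparr>) + small_davenport l (G Mod H)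
    \<le> small_davenport (k + l - 1) G"
proof -
  interpret H: group "G\<lparr>carrier := H\<rparr>" using subgroup.subgroup_is_group[OF is_subgroup is_group] .
  interpret Q: group "G Mod H" using factorgroup_is_group .
  have "finite H" using subset fin by (rule finite_subset)
  then obtain m where m: "small_davenport k (G\<lparr>carrier := H\<rparr>) = enat m"
    using H.small_davenport_finite[of k] by auto
  have "finite (carrier (G Mod H))" using fin by (simp add: carrier_FactGroup)
  then obtain n where n: "small_davenport l (G Mod H) = enat n"
    using Q.small_davenport_finite[of l] by auto
  obtain S where S: "S \<in> sequences_over (G\<lparr>carrier := H\<rparr>)"
      "\<not> divisible_by_product_ones k (G\<lparr>carrier := H\<rparr>) S" "size S = m"
    using small_davenport_attained[OF m k] .
  obtain T where T: "T \<in> sequences_over (G Mod H)"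
      "\<not> divisible_by_product_ones l (G Mod H) T" "size T = n"
    using small_davenport_attained[OF n l] .
  have "set_mset T \<subseteq> (#>) H ` carrier G"
    using T(1) by (auto simp: sequences_over_def carrier_FactGroup)
  then have rep: "inv_into (carrier G) ((#>) H) c \<in> carrier G"
    "H #> inv_into (carrier G) ((#>) H) c = c" if "c \<in># T" for c
    using that by (meson inv_into_into f_inv_into_f subsetD)+
  define R where "R = image_mset (inv_into (carrier G) ((#>) H)) T"
  have RT: "image_mset ((#>) H) R = T"
    unfolding R_def using rep(2) by (simp add: multiset.map_comp o_def cong: image_mset_cong)
  have R: "set_mset R \<subseteq> carrier G" "size R = n"
    unfolding R_def using rep(1) T(3) by auto
  have S': "set_mset S \<subseteq> H" using S(1) by (simp add: sequences_over_def)
  have "\<not> divisible_by_product_ones (k + l - 1) G (S + R)"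
  proof
    assume "divisible_by_product_ones (k + l - 1) G (S + R)"
    then obtain ws where ws: "ws \<in> lists (block_words G {\<one>})" "length ws = k + l - 1"
        "mset (concat ws) \<subseteq># S + R"
      by (auto simp: divisible_by_product_ones_iff_words)
    \<comment> \<open>Group elements may occur both in \<open>S\<close> and in \<open>R\<close>, so each letter is tagged with the part it is
      taken from.\<close>
    define W where "W = image_mset (\<lambda>s. (s, True)) S + image_mset (\<lambda>r. (r, False)) R"
    have "mset (concat ws) \<subseteq># image_mset fst W"
      using ws(3) by (simp add: W_def multiset.map_comp o_def)
    then obtain vs where vs: "map (map fst) vs = ws" "mset (concat vs) \<subseteq># W"
      using words_lift by metis
    let ?in = "\<lambda>v. list_all snd v"
    let ?A = "map (map fst) (filter ?in vs)"
    let ?proj = "\<lambda>v. map (\<lambda>p. H #> fst p) (filter (Not \<circ> snd) v)"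
    let ?B = "map ?proj (filter (Not \<circ> ?in) vs)"
    have W_True: "fst p \<in> H" if "p \<in># W" "snd p" for p
      using that S' by (auto simp: W_def)
    have mem: "p \<in># W" if "v \<in> set vs" "p \<in> set v" for v p
      using that set_mset_mono[OF vs(2)] by auto
    have vw: "map fst v \<in> block_words G {\<one>}" if "v \<in> set vs" for v
      using that vs(1) ws(1) by auto
    have WT: "filter_mset snd W = image_mset (\<lambda>s. (s, True)) S"
      and WF: "filter_mset (Not \<circ> snd) W = image_mset (\<lambda>r. (r, False)) R"
      by (auto simp: W_def filter_mset_image_mset o_def)
    \<comment> \<open>Words whose letters all come from \<open>S\<close>.\<close>
    have "\<not> k \<le> length (filter ?in vs)"
    proof
      assume len: "k \<le> length (filter ?in vs)"
      have "concat (filter ?in vs) = filter snd (concat (filter ?in vs))"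
        by (induction vs) (auto simp: list_all_iff)
      then have "mset (concat (filter ?in vs)) = filter_mset snd (mset (concat (filter ?in vs)))"
        by (metis mset_filter)
      also have "\<dots> \<subseteq># filter_mset snd W"
        using mset_filter_concat_subseteq[OF vs(2)] by (rule multiset_filter_mono)
      finally have "image_mset fst (mset (concat (filter ?in vs))) \<subseteq># image_mset fst (filter_mset snd W)"
        by (rule image_mset_subseteq_mono)
      then have sub: "mset (concat ?A) \<subseteq># S"
        by (simp add: WT multiset.map_comp o_def flip: map_concat)
      have "map fst v \<in> block_words (G\<lparr>carrier := H\<rparr>) {\<one>}" if v: "v \<in> set vs" "?in v" for v
        using vw[OF v(1)] W_True[OF mem[OF v(1)]] v(2)
        by (auto simp: block_words_subgroup[OF subset] list_all_iff)
      then have "?A \<in> lists (block_words (G\<lparr>carrier := H\<rparr>) {\<one>})" by auto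
      then have "divisible_by_product_ones k (G\<lparr>carrier := H\<rparr>) S"
        using sub len by (intro divisible_by_product_onesI[of ?A]) auto
      then show False using S(2) by simp
    qed
    \<comment> \<open>Words with a letter from \<open>R\<close>, reduced to those letters and mapped to the quotient.\<close>
    moreover have "\<not> l \<le> length (filter (Not \<circ> ?in) vs)"
    proof
      assume len: "l \<le> length (filter (Not \<circ> ?in) vs)"
      have "concat ?B = map (\<lambda>p. H #> fst p) (filter (Not \<circ> snd) (concat (filter (Not \<circ> ?in) vs)))"
        by (induction vs) auto
      then have "mset (concat ?B) = image_mset (\<lambda>p. H #> fst p)
          (filter_mset (Not \<circ> snd) (mset (concat (filter (Not \<circ> ?in) vs))))"
        by (simp only: mset_map mset_filter)
      also have "\<dots> \<subseteq># image_mset (\<lambda>p. H #> fst p) (filter_mset (Not \<circ> snd) W)"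
        using mset_filter_concat_subseteq[OF vs(2)]
        by (intro image_mset_subseteq_mono multiset_filter_mono)
      also have "\<dots> = T" unfolding WF by (simp add: multiset.map_comp o_def RT)
      finally have sub: "mset (concat ?B) \<subseteq># T" .
      have "?proj v \<in> block_words (G Mod H) {\<one>\<^bsub>G Mod H\<^esub>}" if v: "v \<in> set vs" "\<not> ?in v" for v
      proof -
        let ?f = "map fst (filter (Not \<circ> snd) v)"
        have carr: "set (map fst v) \<subseteq> carrier G" "word_prod (map fst v) = \<one>"
          using vw[OF v(1)] by (auto simp: block_words_def)
        have carr': "set ?f \<subseteq> carrier G" using carr(1) by auto
        have "H #> word_prod ?f = H #> word_prod (map fst v)"
          using carr(1) W_True[OF mem[OF v(1)]] by (intro coset_word_prod_filter) auto
        then have "H #> word_prod ?f = H" using carr(2) coset_mult_one[OF subset] by simp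
        then have "foldr (\<otimes>\<^bsub>G Mod H\<^esub>) (?proj v) \<one>\<^bsub>G Mod H\<^esub> = \<one>\<^bsub>G Mod H\<^esub>"
          using word_prod_cosets[OF carr'] by (simp add: o_def)
        moreover have "?proj v \<noteq> []" using v(2) by (auto simp: list_all_iff filter_empty_conv)
        moreover have "set (?proj v) \<subseteq> carrier (G Mod H)"
          using carr' by (auto simp: carrier_FactGroup)
        ultimately show ?thesis by (simp add: block_words_def)
      qed
      then have "?B \<in> lists (block_words (G Mod H) {\<one>\<^bsub>G Mod H\<^esub>})" by auto
      then have "divisible_by_product_ones l (G Mod H) T"
        using sub len by (intro divisible_by_product_onesI[of ?B]) auto
      then show False using T(2) by simp
    qed
    moreover have "length (filter ?in vs) + length (filter (Not \<circ> ?in) vs) = k + l - 1"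
      using ws(2) vs(1) sum_length_filter_compl[of ?in vs] by (auto simp: o_def)
    ultimately show False using k l by linarith
  qed
  moreover have "S + R \<in> sequences_over G"
    using S' subset R(1) by (auto simp: sequences_over_def)
  ultimately have "enat (size (S + R)) \<le> small_davenport (k + l - 1) G"
    by (intro small_davenport_geI)
  then show ?thesis using m n S(3) R(2) by simp
qed

end

section \<open>Lengths of factorisations and the large constants\<close>

lemma factors_product_one_iff:
  "factors (product_one_monoid G) fs A \<longleftrightarrow>
     (\<forall>f\<in>set fs. irreducible (product_one_monoid G) f) \<and> sum_list fs = A"
  by (simp add: factors_def product_one_monoid_def sum_list.eq_foldr)

lemma product_one_empty: "product_one G {#}"
  by (auto simp: product_one_def sequences_over_def)

lemma irreducible_product_one_nonempty: "irreducible (product_one_monoid G) A \<Longrightarrow> A \<noteq> {#}"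
  using product_one_empty[of G] by (auto simp: irreducible_def Units_def product_one_monoid_def)

lemma reducible_product_one_split:
  assumes "product_one G A" "A \<noteq> {#}" "\<not> irreducible (product_one_monoid G) A"
  obtains U V where "product_one G U" "product_one G V" "U \<noteq> {#}" "V \<noteq> {#}" "A = U + V"
proof -
  have "A \<notin> Units (product_one_monoid G)"
    using assms(2) by (auto simp: Units_def product_one_monoid_def)
  then obtain U where U: "product_one G U" "properfactor (product_one_monoid G) U A"
      "U \<notin> Units (product_one_monoid G)"
    using assms(3) by (auto simp: irreducible_def product_one_monoid_def)
  then have "U \<noteq> {#}"
    using product_one_empty[of G] by (auto simp: Units_def product_one_monoid_def)
  moreover obtain V where V: "product_one G V" "A = U + V"
    using U(2) by (auto simp: properfactor_def factor_def product_one_monoid_def)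
  moreover have "V \<noteq> {#}"
    using U(2) V product_one_empty[of G]
    by (auto simp: properfactor_def factor_def product_one_monoid_def)
  ultimately show thesis using that U(1) by blast
qed

text \<open>A proper splitting into nontrivial factors shortens both, so refining terminates.\<close>

lemma atomic_factorization_exists:
  assumes "product_one G A"
  obtains fs where "set fs \<subseteq> carrier (product_one_monoid G)" "factors (product_one_monoid G) fs A"
  using assms
proof (induction "size A" arbitrary: A thesis rule: less_induct)
  case less
  consider "A = {#}" | "A \<noteq> {#}" "irreducible (product_one_monoid G) A"
    | "A \<noteq> {#}" "\<not> irreducible (product_one_monoid G) A" by blast
  then show ?case
  proof cases
    case 1
    then show ?thesis using less.prems(1)[of "[]"] by (simp add: factors_product_one_iff)
  next
    case 2
    moreover have "set [A] \<subseteq> carrier (product_one_monoid G)"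
      using less.prems(2) by (simp add: product_one_monoid_def)
    ultimately show ?thesis using less.prems(1)[of "[A]"] by (simp add: factors_product_one_iff)
  next
    case 3
    obtain U V where UV: "product_one G U" "product_one G V" "U \<noteq> {#}" "V \<noteq> {#}" "A = U + V"
      using reducible_product_one_split[OF less.prems(2) 3] .
    have "size U < size A" "size V < size A" using UV by (auto simp: nonempty_has_size)
    then obtain fs gs where "set fs \<subseteq> carrier (product_one_monoid G)" "factors (product_one_monoid G) fs U"
      "set gs \<subseteq> carrier (product_one_monoid G)" "factors (product_one_monoid G) gs V"
      using less.hyps UV(1,2) by metis
    then show ?thesis using less.prems(1)[of "fs @ gs"] UV(5)
      by (auto simp: factors_product_one_iff)
  qed
qed

lemma refine_to_atoms:
  assumes "ws \<in> lists (block_words G {\<one>\<^bsub>G\<^esub>})"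
  obtains fs where "set fs \<subseteq> carrier (product_one_monoid G)"
    "factors (product_one_monoid G) fs (mset (concat ws))" "length ws \<le> length fs"
  using assms
proof (induction ws arbitrary: thesis rule: list.induct)
  case Nil
  then show ?case by (auto simp: factors_product_one_iff intro: Nil.prems(1)[of "[]"])
next
  case (Cons w ws thesis)
  then obtain fs where fs: "set fs \<subseteq> carrier (product_one_monoid G)"
    "factors (product_one_monoid G) fs (mset (concat ws))" "length ws \<le> length fs" by auto
  have w_mem: "w \<in> block_words G {\<one>\<^bsub>G\<^esub>}" using Cons.prems by simp
  have w: "product_one G (mset w)" "w \<noteq> []"
    using w_mem by (auto simp: block_words_def product_one_def sequences_over_def)
  obtain gs where gs: "set gs \<subseteq> carrier (product_one_monoid G)" "factors (product_one_monoid G) gs (mset w)"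
    using atomic_factorization_exists[OF w(1)] .
  have "gs \<noteq> []" using gs(2) w(2) by (auto simp: factors_product_one_iff)
  then have "length (w # ws) \<le> length (gs @ fs)" using fs(3) by (cases gs) auto
  moreover have "factors (product_one_monoid G) (gs @ fs) (mset (concat (w # ws)))"
    using fs(2) gs(2) by (auto simp: factors_product_one_iff)
  ultimately show ?case using Cons.prems(1)[of "gs @ fs"] fs(1) gs(1) by auto
qed

text \<open>Factorisations into arbitrary nontrivial product-one sequences have the same maximal length as those
  into atoms, because refining a factor into atoms can only increase the number of factors. The
  maximum is meaningful because lengths are bounded by the number of terms of \<open>A\<close> and some
  factorisation exists; the default value of \<^const>\<open>Max\<close> on empty or infinite sets never enters.\<close>

lemma Max_length_set_le_iff:
  assumes "product_one G A"
  shows "Max (length_set G A) \<le> k \<longleftrightarrow>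
    (\<forall>ws \<in> lists (block_words G {\<one>\<^bsub>G\<^esub>}). mset (concat ws) = A \<longrightarrow> length ws \<le> k)"
proof -
  have words: "\<exists>ws \<in> lists (block_words G {\<one>\<^bsub>G\<^esub>}). mset (concat ws) = A \<and> length ws = n"
    if n: "n \<in> length_set G A" for n
  proof -
    obtain fs where fs: "n = length fs" "set fs \<subseteq> carrier (product_one_monoid G)"
      "factors (product_one_monoid G) fs A"
      using n by (auto simp: length_set_def)
    have "\<forall>T\<in>set fs. product_one G T" using fs(2) by (auto simp: product_one_monoid_def)
    moreover have "\<forall>T\<in>set fs. T \<noteq> {#}"
      using fs(3) irreducible_product_one_nonempty by (auto simp: factors_product_one_iff)
    ultimately have "\<forall>T\<in>set fs. product_one G T \<and> T \<noteq> {#}" by blast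
    then obtain ws where "map mset ws = fs" "ws \<in> lists (block_words G {\<one>\<^bsub>G\<^esub>})"
      unfolding nontrivial_product_ones_iff_words by (elim exE conjE)
    then show ?thesis using fs by (intro bexI[of _ ws]) (auto simp: mset_concat factors_product_one_iff)
  qed
  have atoms: "\<exists>n \<in> length_set G A. length ws \<le> n"
    if ws: "ws \<in> lists (block_words G {\<one>\<^bsub>G\<^esub>})" "mset (concat ws) = A" for ws
  proof -
    obtain fs where "set fs \<subseteq> carrier (product_one_monoid G)"
      "factors (product_one_monoid G) fs A" "length ws \<le> length fs"
      using refine_to_atoms[OF ws(1)] ws(2) by blast
    then show ?thesis unfolding length_set_def by blast
  qed
  have size: "length ws \<le> size (mset (concat ws))" if "\<forall>w\<in>set ws. w \<noteq> []" for ws :: "'a list list"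
    using that
  proof (induction ws)
    case (Cons w ws)
    then show ?case by (cases w) auto
  qed simp
  have "n \<le> size A" if n: "n \<in> length_set G A" for n
  proof -
    obtain ws where "ws \<in> lists (block_words G {\<one>\<^bsub>G\<^esub>})" "mset (concat ws) = A" "length ws = n"
      using words[OF n] by (elim bexE conjE)
    then show ?thesis using size[of ws] by (auto simp: block_words_def)
  qed
  then have "length_set G A \<subseteq> {..size A}" by auto
  then have fin: "finite (length_set G A)" by (rule finite_subset) simp
  obtain fs where "set fs \<subseteq> carrier (product_one_monoid G)" "factors (product_one_monoid G) fs A"
    using atomic_factorization_exists[OF assms] .
  then have ne: "length_set G A \<noteq> {}" by (auto simp: length_set_def)
  show ?thesis
    unfolding Max_le_iff[OF fin ne]
  proof (intro iffI ballI impI)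
    fix ws
    assume le: "\<forall>n\<in>length_set G A. n \<le> k"
      and ws: "ws \<in> lists (block_words G {\<one>\<^bsub>G\<^esub>})" "mset (concat ws) = A"
    obtain n where "n \<in> length_set G A" "length ws \<le> n" using atoms[OF ws] by (elim bexE)
    then show "length ws \<le> k" using le order_trans by blast
  next
    fix n
    assume le: "\<forall>ws\<in>lists (block_words G {\<one>\<^bsub>G\<^esub>}). mset (concat ws) = A \<longrightarrow> length ws \<le> k"
      and n: "n \<in> length_set G A"
    obtain ws where "ws \<in> lists (block_words G {\<one>\<^bsub>G\<^esub>})" "mset (concat ws) = A" "length ws = n"
      using words[OF n] by (elim bexE conjE)
    then show "n \<le> k" using le by blast
  qed
qed

lemma large_davenport_leD:
  assumes "large_davenport k G \<le> enat D" "product_one G A" "D < size A"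
  obtains ws where "ws \<in> lists (block_words G {\<one>\<^bsub>G\<^esub>})" "mset (concat ws) = A" "k < length ws"
proof -
  have "\<not> Max (length_set G A) \<le> k"
  proof
    assume "Max (length_set G A) \<le> k"
    then have "enat (size A) \<le> large_davenport k G"
      unfolding large_davenport_def using assms(2) by (intro SUP_upper) auto
    then have "enat (size A) \<le> enat D" using assms(1) by (rule order_trans)
    then show False using assms(3) by simp
  qed
  then show thesis using that unfolding Max_length_set_le_iff[OF assms(2)] by (metis not_le)
qed

context group
begin

text \<open>Cut the word after removing its last letter \<open>x\<close>, giving \<open>u w\<^sub>1 \<dots> w\<^sub>s v\<close> with \<open>s \<ge> t\<close> blocks.
  The remaining letters form the cyclic factor \<open>v x u\<close> of the original word. Since a cyclic rotation of a
  product-one word has product one, the product of \<open>v x u\<close> is inverse to that of \<open>w\<^sub>1 \<dots> w\<^sub>s\<close> and so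
  lies in \<open>H\<close>. Holding back \<open>x\<close> guarantees that this additional block is nonempty.\<close>

lemma product_one_word_cyclic_blocks:
  assumes H: "subgroup H G" and fin: "finite (rcosets H)"
    and xs: "set xs \<subseteq> carrier G" "word_prod xs = \<one>" and len: "card (rcosets H) * t < length xs"
  obtains ws where "ws \<in> lists (block_words G H)" "t < length ws" "mset (concat ws) = mset xs"
    "word_prod (concat ws) = \<one>"
proof -
  obtain ys x where ys: "xs = ys @ [x]" using len by (cases xs rule: rev_cases) auto
  have "set ys \<subseteq> carrier G" "card (rcosets H) * t \<le> length ys" using xs(1) len ys by auto
  then obtain u ws v where *: "ys = u @ concat ws @ v" "ws \<in> lists (block_words G H)" "t \<le> length ws"
    using long_word_blocks[OF H fin] by metis
  let ?w = "v @ [x] @ u"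
  have carr: "set ?w \<subseteq> carrier G" "set (concat ws) \<subseteq> carrier G" "set u \<subseteq> carrier G"
      "set (concat ws @ v @ [x]) \<subseteq> carrier G"
    using xs(1) ys *(1) by auto
  have "word_prod (u @ (concat ws @ v @ [x])) = \<one>" using xs(2) ys *(1) by simp
  then have one: "word_prod (concat ws @ ?w) = \<one>"
    using word_prod_rotate[OF carr(3,4)] by simp
  then have one': "word_prod (?w @ concat ws) = \<one>"
    using word_prod_rotate[OF carr(2,1)] by simp
  have "word_prod ?w \<otimes> word_prod (concat ws) = \<one>"
    using one' word_prod_append[OF carr(1,2)] by simp
  then have "word_prod ?w = inv (word_prod (concat ws))"
    using inv_equality[OF _ word_prod_closed[OF carr(2)] word_prod_closed[OF carr(1)]] by simp
  then have "word_prod ?w \<in> H"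
    using word_prod_concat_blocks[OF H *(2)] subgroup.m_inv_closed[OF H] by simp
  then have "?w \<in> block_words G H" using carr(1) by (simp add: block_words_def)
  then show thesis
    using that[of "?w # ws"] *  ys one' by simp
qed

text \<open>If \<open>A\<close> had more than \<open>[G:H] D\<^sub>k(H)\<close> terms, it would split completely into more than \<open>D\<^sub>k(H)\<close>
  blocks whose products form a product-one sequence over \<open>H\<close>. The latter factors into more than
  \<open>k\<close> nontrivial product-one sequences, and by substitution so does \<open>A\<close>.\<close>

theorem large_davenport_index_bound:
  assumes H: "subgroup H G" and fin: "finite (carrier G)"
  shows "large_davenport k G
    \<le> enat (card (rcosets H)) * large_davenport k (G\<lparr>carrier := H\<rparr>)"
proof (cases "large_davenport k (G\<lparr>carrier := H\<rparr>)")
  case infinity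
  then show ?thesis using card_rcosets_pos[OF fin H] by (simp add: enat_0_iff)
next
  case (enat D)
  have "size A \<le> card (rcosets H) * D"
    if A: "product_one G A" "Max (length_set G A) \<le> k" for A
  proof (rule ccontr)
    assume "\<not> ?thesis"
    moreover obtain xs where xs: "mset xs = A" "word_prod xs = \<one>"
      using A(1) by (auto simp: product_one_def)
    ultimately have len: "card (rcosets H) * D < length xs" by auto
    have "set xs \<subseteq> carrier G"
      using A(1) xs(1) by (auto simp: product_one_def sequences_over_def)
    then obtain ws where ws: "ws \<in> lists (block_words G H)" "D < length ws"
        "mset (concat ws) = mset xs" "word_prod (concat ws) = \<one>"
      using product_one_word_cyclic_blocks[OF H finite_rcosets[OF fin H] _ xs(2) len] by metis
    have "word_prod (map word_prod ws) = \<one>"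
      using ws(1,4) word_prod_concat[of ws] by (auto simp: block_words_def)
    moreover have "set (map word_prod ws) \<subseteq> H" using ws(1) by (auto simp: block_words_def)
    ultimately have "product_one (G\<lparr>carrier := H\<rparr>) (mset (map word_prod ws))"
      unfolding product_one_def sequences_over_def by (auto intro!: exI[of _ "map word_prod ws"])
    then obtain xss where xss: "xss \<in> lists (block_words (G\<lparr>carrier := H\<rparr>) {\<one>\<^bsub>G\<lparr>carrier := H\<rparr>\<^esub>})"
        "mset (concat xss) = mset (map word_prod ws)" "k < length xss"
      using large_davenport_leD[of k "G\<lparr>carrier := H\<rparr>" D] enat ws(2) by (metis length_map order_refl size_mset)
    then have "xss \<in> lists (block_words G {\<one>})"
      by (auto simp: block_words_subgroup[OF subgroup.subset[OF H]])
    then obtain yss where "yss \<in> lists (block_words G {\<one>})" "length yss = length xss"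
        "mset (concat yss) = mset (concat ws)"
      using substitute_blocks[OF ws(1), of xss] xss(2) by (metis subset_mset.order_refl)
    then show False
      using A(2) xss(3) ws(3) xs(1) unfolding Max_length_set_le_iff[OF A(1)] by fastforce
  qed
  then show ?thesis
    unfolding enat large_davenport_def[of k G] by (intro SUP_least) auto
qed

end

theorem proposition3p9:
  fixes G :: "('a, 'b) monoid_scheme" and H N :: "'a set" and k l :: nat
  assumes "group G" and "finite (carrier G)"
    and "subgroup H G" and "N \<lhd> G"
    and "k \<ge> 1" and "l \<ge> 1"
  shows
    "(small_davenport k (G\<lparr>carrier := N\<rparr>) + small_davenport l (G Mod N)
       \<le> small_davenport (k + l - 1) G) \<and>
     (\<exists>m. small_davenport k (G\<lparr>carrier := N\<rparr>) = enat m \<and>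
       small_davenport k G \<le> small_davenport (m + 1) (G Mod N)) \<and>
     (small_davenport k G + 1
       \<le> enat (card (rcosets\<^bsub>G\<^esub> H)) * (small_davenport k (G\<lparr>carrier := H\<rparr>) + 1)) \<and>
     (small_davenport k G + 1 \<le> enat k * (small_davenport 1 G + 1)) \<and>
     (large_davenport k G
       \<le> enat (card (rcosets\<^bsub>G\<^esub> H)) * large_davenport k (G\<lparr>carrier := H\<rparr>))"
proof -
  interpret group G by fact
  interpret N: normal N G by fact
  interpret GN: group "G\<lparr>carrier := N\<rparr>"
    using subgroup.subgroup_is_group[OF N.is_subgroup is_group] .
  have "finite N" using N.subset assms(2) by (rule finite_subset)
  then obtain m where m: "small_davenport k (G\<lparr>carrier := N\<rparr>) = enat m"
    using GN.small_davenport_finite[of k] by auto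
  show ?thesis
    using N.small_davenport_extension[OF assms(2,5,6)] m N.small_davenport_le_quotient[OF m]
      small_davenport_index_bound[OF assms(3,2)] small_davenport_le_mult[OF assms(2,5)]
      large_davenport_index_bound[OF assms(3,2)]
    by blast
qed

end
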